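(* For $n\ge 3$, $\chi_{lat}(C_n)=2$ if $n$ is even, and $\chi_{lat}(C_n)=3$ otherwise.
   Context: $C_n$ is the cycle of order $n$. For a finite simple graph $G$ of order $p$ and size $q$, a local antimagic total labeling of $G$ is a bijection $f:V(G)\cup E(G)\to\{1,\ldots,p+q\}$ such that $w_f(u)\neq w_f(v)$ for every edge $uv$ of $G$, where $w_f(u)=f(u)+\sum_{ux\in E(G)}f(ux)$. $\chi_{lat}(G)$ is the minimum number of distinct values of $w_f$ over all local antimagic total labelings $f$ of $G$. *)

theory Defs imports Main begin

text \<open>Undirected graphs as pairs (V, E), with edges as two-element vertex sets.\<close>

type_synonym 'a graph = "'a set \<times> 'a set set"

abbreviation verts :: "'a graph \<Rightarrow> 'a set" where "verts G \<equiv> fst G"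
abbreviation edges :: "'a graph \<Rightarrow> 'a set set" where "edges G \<equiv> snd G"

definition fin_simple_graph :: "'a graph \<Rightarrow> bool" where
  "fin_simple_graph G \<longleftrightarrow>
     finite (verts G) \<and> (\<forall>e\<in>edges G. e \<subseteq> verts G \<and> card e = 2)"

text \<open>A labeling acts on the disjoint union \<open>V <+> E\<close>:
  \<open>f (Inl u)\<close> labels the vertex \<open>u\<close> and \<open>f (Inr e)\<close> labels the edge \<open>e\<close>.\<close>

definition weight :: "'a graph \<Rightarrow> ('a + 'a set \<Rightarrow> nat) \<Rightarrow> 'a \<Rightarrow> nat" where
  "weight G f u = f (Inl u) + (\<Sum>x | {u, x} \<in> edges G. f (Inr {u, x}))"

definition local_antimagic_total_labeling ::
    "'a graph \<Rightarrow> ('a + 'a set \<Rightarrow> nat) \<Rightarrow> bool" where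
  "local_antimagic_total_labeling G f \<longleftrightarrow>
     bij_betw f (verts G <+> edges G) {1..card (verts G) + card (edges G)} \<and>
     (\<forall>u v. {u, v} \<in> edges G \<longrightarrow> weight G f u \<noteq> weight G f v)"

text \<open>Meaningful for finite simple graphs that admit a local antimagic total labeling;
  otherwise the value of \<open>LEAST\<close> is unspecified.\<close>

definition chi_lat :: "'a graph \<Rightarrow> nat" where
  "chi_lat G =
     (LEAST k. \<exists>f. local_antimagic_total_labeling G f \<and> card (weight G f ` verts G) = k)"

text \<open>The cycle on the vertices \<open>0, \<dots>, n - 1\<close>, intended for \<open>n \<ge> 3\<close>
  (for \<open>n = 1\<close> it has a loop, for \<open>n = 2\<close> only one edge).\<close>

definition cycle_graph :: "nat \<Rightarrow> nat graph" where
  "cycle_graph n = ({..<n}, {{i, Suc i mod n} | i. i < n})"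

lemma fin_simple_graph_cycle_graph:
  assumes "n \<ge> 3"
  shows "fin_simple_graph (cycle_graph n)"
proof -
  have "i \<noteq> Suc i mod n" if "i < n" for i
    using that assms by (cases "Suc i = n") auto
  then show ?thesis
    using assms by (auto simp: fin_simple_graph_def cycle_graph_def)
qed

lemma card_verts_cycle_graph: "card (verts (cycle_graph n)) = n"
  by (simp add: cycle_graph_def)

lemma card_edges_cycle_graph:
  assumes "n \<ge> 3"
  shows "card (edges (cycle_graph n)) = n"
proof -
  have "inj_on (\<lambda>i. {i, Suc i mod n}) {..<n}"
  proof (rule inj_onI)
    fix i j assume ij: "i \<in> {..<n}" "j \<in> {..<n}" "{i, Suc i mod n} = {j, Suc j mod n}"
    show "i = j"
    proof (rule ccontr)
      assume "i \<noteq> j"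
      with ij(3) have ij': "i = Suc j mod n" "Suc i mod n = j"
        using \<open>i \<noteq> j\<close> unfolding doubleton_eq_iff by blast+
      have suc_mod: "Suc k mod n = (if Suc k = n then 0 else Suc k)" if "k \<in> {..<n}" for k
        using that by simp
      show False
        using ij'[unfolded suc_mod[OF ij(1)] suc_mod[OF ij(2)]] assms by presburger
    qed
  qed
  then have "card ((\<lambda>i. {i, Suc i mod n}) ` {..<n}) = n" by (simp add: card_image)
  moreover have "edges (cycle_graph n) = (\<lambda>i. {i, Suc i mod n}) ` {..<n}"
    by (auto simp: cycle_graph_def)
  ultimately show ?thesis by simp
qed

end

theory Submission imports Defs begin

text \<open>
  Two adjacent vertices never have equal weights, so the weights form a proper vertex colouring
  of the cycle.  Hence at least two weights occur, and at least three if the cycle is odd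
  (\<open>proper_odd_cycle_colours\<close>).  It remains to construct labelings that attain these bounds.

  Write \<open>v i\<close> for the label of the vertex \<open>i\<close> and \<open>e i\<close> for the label of the edge from \<open>i\<close> to its
  successor, so that the weight of \<open>i\<close> is \<open>v i + e (i - 1) + e i\<close>.  All constructions let every
  family of labels run through an arithmetic progression as \<open>i\<close> advances in steps of two (or four).
  A weight stays constant along such a family of vertices exactly if the step of its vertex labels
  is minus the sum of the steps of the two families of edge labels.  What has to be arranged is that
  the progressions tile \<open>{1..2 * n}\<close>, and that the weight also comes out right where the cycle
  closes up.

  \<^item> If \<open>n\<close> is odd, both edge families have step \<open>1\<close> and both vertex families have step \<open>-2\<close>;
    the vertex \<open>0\<close> takes the third weight and so absorbs the closing defect
    (\<open>odd_cycle_three_weights\<close>).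

  \<^item> If \<open>n = 4 * h + 2\<close>, the same steps work when read modulo the odd number \<open>2 * h + 1\<close>: a
    progression with step \<open>-2\<close> then visits every residue, so each of the four families fills an
    interval of length \<open>2 * h + 1\<close> (\<open>cycle_two_weights_2_mod_4\<close>).

  \<^item> If \<open>n = 4 * k\<close>, then \<open>2\<close> is not invertible modulo the length of the families.  Here the indices
    are split modulo 4: the edge families have steps \<open>1, -2, 1, -2\<close>, hence all vertex families
    have step \<open>1\<close> (\<open>cycle_two_weights_0_mod_4\<close>).  The two weights that arise differ by \<open>k - 1\<close>,
    so \<open>n = 4\<close> needs a labeling of its own.
\<close>

section \<open>Weights on a cycle\<close>

lemma edges_cycle_graph: "edges (cycle_graph n) = (\<lambda>i. {i, Suc i mod n}) ` {..<n}"
  by (auto simp: cycle_graph_def)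

lemma inj_on_cycle_edge:
  assumes "n \<ge> 3"
  shows "inj_on (\<lambda>i. {i, Suc i mod n}) {..<n}"
  using card_edges_cycle_graph[OF assms]
  by (intro eq_card_imp_inj_on) (simp_all add: edges_cycle_graph)

lemma cycle_edges_cases:
  assumes "{u, x} \<in> edges (cycle_graph n)"
  obtains i where "Suc i < n" "{u, x} = {i, Suc i}" | "0 < n" "{u, x} = {n - 1, 0}"
proof -
  obtain i where i: "i < n" "{u, x} = {i, Suc i mod n}"
    using assms by (auto simp: cycle_graph_def)
  show ?thesis
  proof (cases "Suc i = n")
    case True
    then have "n - 1 = i" "Suc i mod n = 0" "0 < n" by simp_all
    then show ?thesis using i(2) that(2) by simp
  next
    case False
    then have "Suc i < n" using i(1) by simp
    then show ?thesis using i(2) that(1) by simp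
  qed
qed

lemma cycle_edge_step: "Suc i < n \<Longrightarrow> {i, Suc i} \<in> edges (cycle_graph n)"
  unfolding edges_cycle_graph by (rule image_eqI[where x = i]) auto

lemma cycle_edge_close: "0 < n \<Longrightarrow> {n - 1, 0} \<in> edges (cycle_graph n)"
  unfolding edges_cycle_graph by (rule image_eqI[where x = "n - 1"]) auto

lemma weight_cycle_0:
  assumes "n \<ge> 3"
  shows "weight (cycle_graph n) f 0 = f (Inl 0) + f (Inr {n - 1, 0}) + f (Inr {0, Suc 0})"
proof -
  have "{x. {0, x} \<in> edges (cycle_graph n)} = {n - 1, 1}"
  proof (intro equalityI subsetI)
    fix x assume "x \<in> {x. {0, x} \<in> edges (cycle_graph n)}"
    then have "{0, x} \<in> edges (cycle_graph n)" by simp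
    then show "x \<in> {n - 1, 1}"
      using assms by (elim cycle_edges_cases) (auto simp: doubleton_eq_iff)
  next
    fix x assume "x \<in> {n - 1, 1}"
    then show "x \<in> {x. {0, x} \<in> edges (cycle_graph n)}"
      using assms cycle_edge_step[of 0 n] cycle_edge_close[of n] by (auto simp: insert_commute)
  qed
  then show ?thesis
    using assms by (simp add: weight_def insert_commute)
qed

lemma weight_cycle_Suc:
  assumes "n \<ge> 3" "Suc i < n"
  shows "weight (cycle_graph n) f (Suc i)
    = f (Inl (Suc i)) + f (Inr {i, Suc i}) + f (Inr {Suc i, Suc (Suc i) mod n})"
proof -
  let ?s = "Suc (Suc i) mod n"
  have s: "?s = (if Suc (Suc i) = n then 0 else Suc (Suc i))"
    using assms by auto
  then have ne: "i \<noteq> ?s" using assms by auto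
  have "{x. {Suc i, x} \<in> edges (cycle_graph n)} = {i, ?s}"
  proof (intro equalityI subsetI)
    fix x assume "x \<in> {x. {Suc i, x} \<in> edges (cycle_graph n)}"
    then have "{Suc i, x} \<in> edges (cycle_graph n)" by simp
    then show "x \<in> {i, ?s}"
      unfolding s using assms by (elim cycle_edges_cases) (auto simp: doubleton_eq_iff)
  next
    fix x assume "x \<in> {i, ?s}"
    then show "x \<in> {x. {Suc i, x} \<in> edges (cycle_graph n)}"
      using assms cycle_edge_step[of i n]
      by (auto simp: insert_commute edges_cycle_graph intro: image_eqI[where x = "Suc i"])
  qed
  then show ?thesis
    using ne by (simp add: weight_def insert_commute)
qed

section \<open>Lower bounds\<close>

lemma local_antimagic_cycle_adjacent:
  assumes "local_antimagic_total_labeling (cycle_graph n) f"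
  shows "Suc i < n \<Longrightarrow> weight (cycle_graph n) f i \<noteq> weight (cycle_graph n) f (Suc i)"
    and "0 < n \<Longrightarrow> weight (cycle_graph n) f (n - 1) \<noteq> weight (cycle_graph n) f 0"
  using assms cycle_edge_step[of i n] cycle_edge_close[of n]
  unfolding local_antimagic_total_labeling_def by blast+

lemma proper_cycle_colours:
  fixes w :: "nat \<Rightarrow> 'c"
  assumes "2 \<le> n" and "w 0 \<noteq> w 1"
  shows "2 \<le> card (w ` {..<n})"
proof -
  have "card {w 0, w 1} \<le> card (w ` {..<n})"
    using assms by (intro card_mono) auto
  then show ?thesis using assms by simp
qed

text \<open>With only two colours, the colour of a vertex is determined by its parity; on an odd
  cycle the last vertex then has the colour of its neighbour \<open>0\<close>.\<close>

lemma proper_odd_cycle_colours: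
  fixes w :: "nat \<Rightarrow> 'c"
  assumes "odd n" "2 \<le> n"
    and adjacent: "\<And>i. Suc i < n \<Longrightarrow> w i \<noteq> w (Suc i)" and close: "w (n - 1) \<noteq> w 0"
  shows "3 \<le> card (w ` {..<n})"
proof (rule ccontr)
  assume few: "\<not> ?thesis"
  have ne: "w 0 \<noteq> w 1" using adjacent[of 0] assms(2) by simp
  have sub: "{w 0, w 1} \<subseteq> w ` {..<n}" using assms(2) by auto
  have "w ` {..<n} = {w 0, w 1}"
    using card_seteq[OF _ sub] few ne by simp
  then have two: "w i = w 0 \<or> w i = w 1" if "i < n" for i
    using that by blast
  have "w i = (if even i then w 0 else w 1)" if "i < n" for i
    using that
  proof (induction i)
    case (Suc i)
    then show ?case using adjacent[of i] two[of "Suc i"] by (auto split: if_splits)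
  qed simp
  from this[of "n - 1"] show False using close assms(1,2) by simp
qed

lemma chi_lat_eqI:
  assumes "\<exists>f. local_antimagic_total_labeling G f \<and> weight G f ` verts G \<subseteq> S"
    and "finite S" "card S \<le> k"
    and lower: "\<And>f. local_antimagic_total_labeling G f \<Longrightarrow> k \<le> card (weight G f ` verts G)"
  shows "chi_lat G = k"
proof -
  obtain f where f: "local_antimagic_total_labeling G f" "weight G f ` verts G \<subseteq> S"
    using assms(1) by blast
  have "card (weight G f ` verts G) = k"
    using card_mono[OF assms(2) f(2)] assms(3) lower[OF f(1)] by simp
  then show ?thesis
    unfolding chi_lat_def using f(1) lower by (intro Least_equality) auto
qed

section \<open>Labelings of a cycle from vertex and edge sequences\<close>

text \<open>Since there are exactly \<open>2 * n\<close> vertices and edges, it suffices that every label occurs;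
  no label can then occur twice.\<close>

lemma cycle_labelingI:
  fixes v e c :: "nat \<Rightarrow> nat"
  assumes n: "3 \<le> n"
    and cover: "\<And>l. 1 \<le> l \<Longrightarrow> l \<le> 2 * n \<Longrightarrow> \<exists>i<n. v i = l \<or> e i = l"
    and w0: "v 0 + e (n - 1) + e 0 = c 0"
    and wSuc: "\<And>i. Suc i < n \<Longrightarrow> v (Suc i) + e i + e (Suc i) = c (Suc i)"
    and adjacent: "\<And>i. Suc i < n \<Longrightarrow> c i \<noteq> c (Suc i)" and close: "c (n - 1) \<noteq> c 0"
    and range: "\<And>i. i < n \<Longrightarrow> c i \<in> S"
  shows "\<exists>f. local_antimagic_total_labeling (cycle_graph n) f \<and>
    weight (cycle_graph n) f ` verts (cycle_graph n) \<subseteq> S"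
proof -
  let ?G = "cycle_graph n" and ?E = "\<lambda>i. {i, Suc i mod n}"
  let ?D = "verts ?G <+> edges ?G"
  define f where "f = case_sum v (\<lambda>x. e (the_inv_into {..<n} ?E x))"
  have fE: "f (Inr (?E i)) = e i" if "i < n" for i
    using the_inv_into_f_f[OF inj_on_cycle_edge[OF n], of i] that by (simp add: f_def)
  have fV: "f (Inl i) = v i" for i by (simp add: f_def)
  have fin: "finite ?D" and cardD: "card ?D = 2 * n"
    using n card_edges_cycle_graph[OF n] card_verts_cycle_graph[of n]
    by (auto simp: card_Plus edges_cycle_graph cycle_graph_def)
  have "{1..2 * n} \<subseteq> f ` ?D"
  proof
    fix l assume "l \<in> {1..2 * n}"
    then obtain i where i: "i < n" "v i = l \<or> e i = l" using cover[of l] by auto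
    then have "f (Inl i) = l \<or> f (Inr (?E i)) = l" by (simp only: fE fV)
    moreover have "Inl i \<in> ?D" "Inr (?E i) \<in> ?D"
      using i(1) by (auto simp: cycle_graph_def)
    ultimately show "l \<in> f ` ?D" by blast
  qed
  moreover have "card (f ` ?D) \<le> card {1..2 * n}"
    using card_image_le[OF fin, of f] cardD by simp
  ultimately have img: "f ` ?D = {1..2 * n}"
    using card_seteq[of "f ` ?D" "{1..2 * n}"] fin by simp
  then have bij: "bij_betw f ?D {1..card (verts ?G) + card (edges ?G)}"
    using eq_card_imp_inj_on[OF fin, of f] cardD card_edges_cycle_graph[OF n]
    by (simp add: bij_betw_def card_verts_cycle_graph mult_2)
  have weight: "weight ?G f i = c i" if "i < n" for i
  proof (cases i)
    case 0
    have "{n - 1, 0} = ?E (n - 1)" "{0, Suc 0} = ?E 0" using n by auto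
    then show ?thesis
      using 0 n w0 fE[of "n - 1"] fE[of 0] by (simp add: weight_cycle_0 fV del: One_nat_def)
  next
    case (Suc j)
    have "{j, Suc j} = ?E j" using Suc that by simp
    then show ?thesis
      using Suc that n wSuc[of j] fE[of j] fE[of "Suc j"] by (simp add: weight_cycle_Suc fV)
  qed
  have "weight ?G f x \<noteq> weight ?G f y" if "{x, y} \<in> edges ?G" for x y
    using that
  proof (cases rule: cycle_edges_cases)
    case (1 i)
    then have "weight ?G f i \<noteq> weight ?G f (Suc i)"
      using adjacent[of i] by (simp add: weight)
    with 1 show ?thesis by (auto simp: doubleton_eq_iff)
  next
    case 2
    then have "weight ?G f (n - 1) \<noteq> weight ?G f 0"
      using close by (simp add: weight)
    with 2 show ?thesis by (auto simp: doubleton_eq_iff)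
  qed
  with bij have "local_antimagic_total_labeling ?G f"
    unfolding local_antimagic_total_labeling_def by blast
  moreover have "weight ?G f ` verts ?G \<subseteq> S"
    using weight range by (auto simp: cycle_graph_def)
  ultimately show ?thesis by blast
qed

section \<open>Constructions\<close>

text \<open>For \<open>h = 2\<close>, that is \<open>n = 5\<close>, the vertex labels are \<open>10, 8, 9, 6, 7\<close> and the edge labels are
  \<open>1, 4, 2, 5, 3\<close>.  Giving the largest label to the vertex \<open>0\<close> leaves exactly the interval
  \<open>{2 * h + 2..4 * h + 1}\<close> for the other vertices; their two weights differ by two, so that one
  family takes the odd and the other the even labels of it.\<close>

lemma odd_cycle_three_weights:
  assumes h: "1 \<le> h" and n: "n = 2 * h + 1"
  shows "\<exists>f. local_antimagic_total_labeling (cycle_graph n) f \<and>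
    weight (cycle_graph n) f ` verts (cycle_graph n) \<subseteq> {5 * h + 3, 5 * h + 4, 5 * h + 5}"
proof -
  define v where "v i = (if i = 0 then 4 * h + 2 else if even i then 4 * h + 3 - 2 * (i div 2)
    else 4 * h - 2 * (i div 2))" for i :: nat
  define e where "e i = (if even i then i div 2 + 1 else h + 2 + i div 2)" for i :: nat
  define c where "c i = (if i = 0 then 5 * h + 4 else if even i then 5 * h + 5 else 5 * h + 3)"
    for i :: nat
  show ?thesis
  proof (rule cycle_labelingI[where v = v and e = e and c = c])
    fix l :: nat assume l: "1 \<le> l" "l \<le> 2 * n"
    obtain j where j: "l = 2 * j \<or> l = 2 * j + 1"
      using that[of "l div 2"] by linarith
    consider "l \<le> h + 1" | "h + 2 \<le> l" "l \<le> 2 * h + 1"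
      | "l = 2 * j" "h + 1 \<le> j" "j \<le> 2 * h"
      | "l = 2 * j + 1" "h + 1 \<le> j" "j \<le> 2 * h" | "l = 4 * h + 2"
      using l n j by linarith
    then show "\<exists>i<n. v i = l \<or> e i = l"
    proof cases
      case 1
      then show ?thesis using l n by (intro exI[of _ "2 * (l - 1)"]) (auto simp: e_def)
    next
      case 2
      then show ?thesis using n by (intro exI[of _ "2 * (l - h - 2) + 1"]) (auto simp: e_def)
    next
      case 3
      then show ?thesis using n by (intro exI[of _ "2 * (2 * h - j) + 1"]) (auto simp: v_def)
    next
      case 4
      then show ?thesis using n by (intro exI[of _ "2 * (2 * h + 1 - j)"]) (auto simp: v_def)
    next
      case 5
      then show ?thesis using n by (intro exI[of _ 0]) (auto simp: v_def)
    qed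
  next
    fix i assume "Suc i < n"
    then show "v (Suc i) + e i + e (Suc i) = c (Suc i)"
      using n by (cases "even i") (auto simp: v_def e_def c_def elim!: evenE oddE)
  qed (use h n in \<open>auto simp: v_def e_def c_def\<close>)
qed

text \<open>With \<open>m = 2 * h + 1\<close>, the even edges take \<open>{1..m}\<close>, the odd edges \<open>{m + 1..2 * m}\<close>, the odd
  vertices \<open>{2 * m + 1..3 * m}\<close> and the even vertices \<open>{3 * m + 1..4 * m}\<close>.  The odd edges start
  just above the middle of their interval, so that they wrap around half a turn away from the even
  ones, which wrap where the cycle closes up.
  Each wrap lifts the vertex labels by \<open>m\<close>, from one parity to the other.\<close>

lemma cycle_two_weights_2_mod_4:
  assumes h: "1 \<le> h" and n: "n = 4 * h + 2"
  shows "\<exists>f. local_antimagic_total_labeling (cycle_graph n) f \<and>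
    weight (cycle_graph n) f ` verts (cycle_graph n) \<subseteq> {9 * h + 6, 11 * h + 7}"
proof -
  define v where "v i = (let j = i div 2 in
    if even i then (if j \<le> h then 8 * h + 4 - 2 * j else 10 * h + 5 - 2 * j)
    else (if j < h then 6 * h + 2 - 2 * j else 8 * h + 3 - 2 * j))" for i :: nat
  define e where "e i = (let j = i div 2 in
    if even i then 1 + j else (if j < h then 3 * h + 3 + j else h + 2 + j))" for i :: nat
  define c where "c i = (if even i then 11 * h + 7 else 9 * h + 6)" for i :: nat
  have v: "v (2 * j) = (if j \<le> h then 8 * h + 4 - 2 * j else 10 * h + 5 - 2 * j)"
    "v (Suc (2 * j)) = (if j < h then 6 * h + 2 - 2 * j else 8 * h + 3 - 2 * j)" for j
    by (simp_all add: v_def)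
  have e: "e (2 * j) = 1 + j" "e (Suc (2 * j)) = (if j < h then 3 * h + 3 + j else h + 2 + j)" for j
    by (simp_all add: e_def)
  show ?thesis
  proof (rule cycle_labelingI[where v = v and e = e and c = c])
    fix l :: nat assume l: "1 \<le> l" "l \<le> 2 * n"
    obtain j where j: "l = 2 * j \<or> l = 2 * j + 1"
      using that[of "l div 2"] by linarith
    consider "l \<le> 2 * h + 1" | "2 * h + 2 \<le> l" "l \<le> 3 * h + 2" | "3 * h + 3 \<le> l" "l \<le> 4 * h + 2"
      | "l = 2 * j" "2 * h + 2 \<le> j" "j \<le> 3 * h + 1"
      | "l = 2 * j + 1" "2 * h + 1 \<le> j" "j \<le> 3 * h + 1"
      | "l = 2 * j" "3 * h + 2 \<le> j" "j \<le> 4 * h + 2"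
      | "l = 2 * j + 1" "3 * h + 2 \<le> j" "j \<le> 4 * h + 1"
      using l n j by linarith
    then show "\<exists>i<n. v i = l \<or> e i = l"
    proof cases
      case 1
      then show ?thesis using l n by (intro exI[of _ "2 * (l - 1)"]) (auto simp: e)
    next
      case 2
      then show ?thesis using n by (intro exI[of _ "2 * (l - h - 2) + 1"]) (auto simp: e)
    next
      case 3
      then show ?thesis using n by (intro exI[of _ "2 * (l - 3 * h - 3) + 1"]) (auto simp: e)
    next
      case 4
      then show ?thesis using n by (intro exI[of _ "2 * (3 * h + 1 - j) + 1"]) (auto simp: v)
    next
      case 5
      then show ?thesis using n by (intro exI[of _ "2 * (4 * h + 1 - j) + 1"]) (auto simp: v)
    next
      case 6
      then show ?thesis using n by (intro exI[of _ "2 * (4 * h + 2 - j)"]) (auto simp: v)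
    next
      case 7
      then show ?thesis using n by (intro exI[of _ "2 * (5 * h + 2 - j)"]) (auto simp: v)
    qed
  next
    fix i assume "Suc i < n"
    then show "v (Suc i) + e i + e (Suc i) = c (Suc i)"
      using n by (cases "even i") (auto simp: v_def e_def c_def Let_def elim!: evenE oddE)
  qed (use h n in \<open>auto simp: v_def e_def c_def Let_def\<close>)
qed

text \<open>The edges take the intervals \<open>{2 * k + 1..3 * k}\<close> and \<open>{5 * k + 1..6 * k}\<close>, and, with the two
  progressions of step \<open>-2\<close> interleaved, \<open>{6 * k + 1..8 * k}\<close>.  Closing up the cycle affects only
  the vertex \<open>0\<close>: its label is \<open>2 * k\<close> above the term \<open>3 * k\<close> that its progression calls for.
  The rest of that progression is \<open>{3 * k + 1..4 * k - 1}\<close>, and the gap of length \<open>k\<close> that remains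
  below \<open>5 * k\<close> is just filled by the labels of the vertices congruent to 1 modulo 4.\<close>

lemma cycle_two_weights_0_mod_4:
  assumes k: "2 \<le> k" and n: "n = 4 * k"
  shows "\<exists>f. local_antimagic_total_labeling (cycle_graph n) f \<and>
    weight (cycle_graph n) f ` verts (cycle_graph n) \<subseteq> {13 * k + 2, 14 * k + 1}"
proof -
  define v where "v i = (let j = i div 4 in
    if i = 0 then 5 * k else if i mod 4 = 0 then 3 * k + j
    else if i mod 4 = 1 then 4 * k + j else if i mod 4 = 2 then 1 + j else k + 1 + j)" for i :: nat
  define e where "e i = (let j = i div 4 in
    if i mod 4 = 0 then 2 * k + 1 + j else if i mod 4 = 1 then 8 * k - 2 * j
    else if i mod 4 = 2 then 5 * k + 1 + j else 8 * k - 1 - 2 * j)" for i :: nat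
  define c where "c i = (if even i then 13 * k + 2 else 14 * k + 1)" for i :: nat
  have [simp]: "Suc (4 * j) div 4 = j" "Suc (Suc (4 * j)) mod 4 = 2" "Suc (Suc (4 * j)) div 4 = j" for j :: nat
    by presburger+
  have v: "v (4 * j) = (if j = 0 then 5 * k else 3 * k + j)" "v (Suc (4 * j)) = 4 * k + j"
    "v (Suc (Suc (4 * j))) = 1 + j" "v (4 * j + 3) = k + 1 + j" for j
    by (simp_all add: v_def)
  have e: "e (4 * j) = 2 * k + 1 + j" "e (Suc (4 * j)) = 8 * k - 2 * j"
    "e (Suc (Suc (4 * j))) = 5 * k + 1 + j" "e (4 * j + 3) = 8 * k - 1 - 2 * j" for j
    by (simp_all add: e_def)
  show ?thesis
  proof (rule cycle_labelingI[where v = v and e = e and c = c])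
    fix l :: nat assume l: "1 \<le> l" "l \<le> 2 * n"
    consider "l \<le> 3 * k" | "3 * k + 1 \<le> l" "l \<le> 6 * k" | "6 * k + 1 \<le> l" by linarith
    then show "\<exists>i<n. v i = l \<or> e i = l"
    proof cases
      case 1
      then consider "l \<le> k" | "k + 1 \<le> l" "l \<le> 2 * k" | "2 * k + 1 \<le> l" "l \<le> 3 * k"
        by linarith
      then show ?thesis
      proof cases
        case 1
        then show ?thesis using l n by (intro exI[of _ "4 * (l - 1) + 2"]) (auto simp: v)
      next
        case 2
        then show ?thesis using n by (intro exI[of _ "4 * (l - k - 1) + 3"]) (auto simp: v)
      next
        case 3
        then show ?thesis using n by (intro exI[of _ "4 * (l - 2 * k - 1)"]) (auto simp: e)
      qed
    next
      case 2
      then consider "3 * k + 1 \<le> l" "l \<le> 4 * k - 1" | "4 * k \<le> l" "l \<le> 5 * k - 1" | "l = 5 * k"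
        | "5 * k + 1 \<le> l" "l \<le> 6 * k"
        by linarith
      then show ?thesis
      proof cases
        case 1
        then show ?thesis using n by (intro exI[of _ "4 * (l - 3 * k)"]) (auto simp: v)
      next
        case 2
        then show ?thesis using k n by (intro exI[of _ "4 * (l - 4 * k) + 1"]) (auto simp: v)
      next
        case 3
        then show ?thesis using k n by (intro exI[of _ "0"]) (auto simp: v_def)
      next
        case 4
        then show ?thesis using n by (intro exI[of _ "4 * (l - 5 * k - 1) + 2"]) (auto simp: e)
      qed
    next
      case 3
      obtain j where j: "l = 2 * j \<or> l = 2 * j + 1"
        using that[of "l div 2"] by linarith
      with 3 l n consider "l = 2 * j" "3 * k + 1 \<le> j" "j \<le> 4 * k"
        | "l = 2 * j + 1" "3 * k \<le> j" "j \<le> 4 * k - 1"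
        by linarith
      then show ?thesis
      proof cases
        case 1
        then show ?thesis using n by (intro exI[of _ "4 * (4 * k - j) + 1"]) (auto simp: e)
      next
        case 2
        then show ?thesis using k n by (intro exI[of _ "4 * (4 * k - 1 - j) + 3"]) (auto simp: e)
      qed
    qed
  next
    fix i assume i: "Suc i < n"
    define q where "q = i div 4"
    consider "i = 4 * q" | "i = 4 * q + 1" | "i = 4 * q + 2" | "i = 4 * q + 3"
      unfolding q_def by linarith
    then show "v (Suc i) + e i + e (Suc i) = c (Suc i)"
    proof cases
      case 1
      then show ?thesis using i n v(2)[of q] e(1,2)[of q] by (simp add: c_def)
    next
      case 2
      then show ?thesis using i n v(3)[of q] e(2,3)[of q] by (simp add: c_def)
    next
      case 3
      then show ?thesis using i n v(4)[of q] e(3,4)[of q] by (simp add: c_def numeral_3_eq_3)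
    next
      case 4
      then have "Suc i = 4 * Suc q" by simp
      then show ?thesis
        using 4 i n v(1)[of "Suc q"] e(1)[of "Suc q"] e(4)[of q] by (simp add: c_def)
    qed
  next
    have "n - 1 = 4 * (k - 1) + 3" using k n by simp
    then show "v 0 + e (n - 1) + e 0 = c 0"
      using k v(1)[of 0] e(1)[of 0] e(4)[of "k - 1"] by (simp add: c_def)
  next
    fix i assume "Suc i < n"
    show "c i \<noteq> c (Suc i)" using k by (simp add: c_def)
  qed (use k n in \<open>auto simp: c_def\<close>)
qed

lemma cycle_4_two_weights:
  "\<exists>f. local_antimagic_total_labeling (cycle_graph 4) f \<and>
    weight (cycle_graph 4) f ` verts (cycle_graph 4) \<subseteq> {12, 16}"
proof (rule cycle_labelingI[where v = "(!) [1, 4, 3, 8]" and e = "(!) [5, 7, 2, 6]"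
      and c = "\<lambda>i. if even i then 12 else 16"])
  have ex: "(\<exists>i<4. P i) \<longleftrightarrow> P 0 \<or> P 1 \<or> P 2 \<or> P 3" for P :: "nat \<Rightarrow> bool"
    by (auto simp: eval_nat_numeral less_Suc_eq)
  fix l :: nat assume "1 \<le> l" "l \<le> 2 * 4"
  then have "l \<in> {1, 2, 3, 4, 5, 6, 7, 8}" by auto
  then show "\<exists>i<4. [1, 4, 3, 8] ! i = l \<or> [5, 7, 2, 6] ! i = l"
    unfolding ex by auto
next
  fix i :: nat assume "Suc i < 4"
  then have "i \<in> {0, 1, 2}" by auto
  then show "[1, 4, 3, 8] ! Suc i + [5, 7, 2, 6] ! i + [5, 7, 2, 6] ! Suc i
    = (if even (Suc i) then 12 else (16::nat))"
    by auto
qed auto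

theorem theorem3p16:
  fixes n :: nat
  assumes "n \<ge> 3"
  shows "chi_lat (cycle_graph n) = (if even n then 2 else 3)"
proof (cases "even n")
  case True
  have lower: "2 \<le> card (weight (cycle_graph n) f ` verts (cycle_graph n))"
    if "local_antimagic_total_labeling (cycle_graph n) f" for f
    using proper_cycle_colours[of n "weight (cycle_graph n) f"]
      local_antimagic_cycle_adjacent(1)[OF that, of 0] assms
    by (simp add: cycle_graph_def)
  have two: "card {a, b} \<le> 2" for a b :: nat
    by (cases "a = b") auto
  consider h where "n = 4 * h + 2" "1 \<le> h" | k where "n = 4 * k" "2 \<le> k" | "n = 4"
  proof -
    obtain m where m: "n = 2 * m" using True by (elim evenE)
    show ?thesis
    proof (cases "even m")
      case True
      then obtain k where "m = 2 * k" by (elim evenE)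
      with m assms show ?thesis using that(2)[of k] that(3) by (cases "k = 1") auto
    next
      case False
      then obtain h where "m = 2 * h + 1" by (elim oddE)
      with m assms show ?thesis using that(1)[of h] by auto
    qed
  qed
  then have "chi_lat (cycle_graph n) = 2"
  proof cases
    case 1
    show ?thesis
      by (rule chi_lat_eqI[OF cycle_two_weights_2_mod_4[OF 1(2,1)]]) (use two lower in auto)
  next
    case 2
    show ?thesis
      by (rule chi_lat_eqI[OF cycle_two_weights_0_mod_4[OF 2(2,1)]]) (use two lower in auto)
  next
    case 3
    show ?thesis
      unfolding 3
      by (rule chi_lat_eqI[OF cycle_4_two_weights]) (use two lower 3 in auto)
  qed
  with True show ?thesis by simp
next
  case False
  then obtain h where h: "n = 2 * h + 1" by (elim oddE)
  with assms have "1 \<le> h" by simp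
  have "chi_lat (cycle_graph n) = 3"
  proof (rule chi_lat_eqI[OF odd_cycle_three_weights[OF \<open>1 \<le> h\<close> h]])
    fix f assume "local_antimagic_total_labeling (cycle_graph n) f"
    note adjacent = local_antimagic_cycle_adjacent[OF this]
    show "3 \<le> card (weight (cycle_graph n) f ` verts (cycle_graph n))"
      using proper_odd_cycle_colours[of n "weight (cycle_graph n) f"] adjacent False assms
      by (simp add: cycle_graph_def)
  qed auto
  with False show ?thesis by simp
qed

end
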